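(* Suppose that $f:\mathbb{R}^d\to(-\infty,+\infty]$ is differentiable and satisfies the Polyak–Łojasiewicz inequality with constant $\alpha>0$ ($\alpha$-PL). Let $\eta>0$, $x\in\mathbb{R}^d$, let $x'\in\operatorname{prox}_{\eta f}(x)$, and write $f^\star=\inf f$. Then $$f(x')-f^\star\le\frac{1}{(1+\alpha\eta)^2}\,\{f(x)-f^\star\}.$$
   Context: $f$ satisfies $\alpha$-PL if $\|\nabla f(x)\|^2\ge2\alpha\,(f(x)-\inf f)$ for all $x$. The proximal mapping is $\operatorname{prox}_{\eta f}(y)=\operatorname{argmin}_{x\in\mathbb{R}^d}\{f(x)+\frac1{2\eta}\|x-y\|^2\}$, understood as the set of all minimizers. *)

theory Defs
  imports "HOL-Analysis.Analysis"
begin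

text \<open>
  Functions with values in the half-open extended line are rendered as functions into
  \<^typ>\<open>ereal\<close> that avoid \<^term>\<open>-\<infinity>::ereal\<close>.  Since
  \<^const>\<open>real_of_ereal\<close> sends both infinities to \<open>0\<close>, differentiability at a point must
  require finiteness near that point explicitly.
\<close>

definition ext_differentiable_at :: "('a::real_normed_vector \<Rightarrow> ereal) \<Rightarrow> 'a \<Rightarrow> bool" where
  "ext_differentiable_at f x \<longleftrightarrow>
     (\<forall>\<^sub>F y in nhds x. \<bar>f y\<bar> \<noteq> \<infinity>) \<and> (\<lambda>y. real_of_ereal (f y)) differentiable (at x)"

definition ext_differentiable :: "('a::real_normed_vector \<Rightarrow> ereal) \<Rightarrow> bool" where
  "ext_differentiable f \<longleftrightarrow> (\<forall>x. ext_differentiable_at f x)"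

definition ext_gradient :: "('a::real_inner \<Rightarrow> ereal) \<Rightarrow> 'a \<Rightarrow> 'a" where
  "ext_gradient f x = (THE D. GDERIV (\<lambda>y. real_of_ereal (f y)) x :> D)"

lemma ext_gradient_eq:
  assumes "GDERIV (\<lambda>y. real_of_ereal (f y)) x :> D"
  shows "ext_gradient f x = D"
  unfolding ext_gradient_def
proof (rule the_equality)
  fix E assume "GDERIV (\<lambda>y. real_of_ereal (f y)) x :> E"
  with assms have "(\<lambda>h. h \<bullet> E) = (\<lambda>h. h \<bullet> D)"
    unfolding gderiv_def by (blast intro: has_derivative_unique)
  then have "(E - D) \<bullet> E = (E - D) \<bullet> D" by (rule fun_cong)
  then have "(E - D) \<bullet> (E - D) = 0" by (simp only: inner_diff_right diff_self)
  then show "E = D" by simp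
qed (fact assms)

lemma GDERIV_ext_gradient:
  fixes f :: "'a::euclidean_space \<Rightarrow> ereal"
  assumes "ext_differentiable_at f x"
  shows "GDERIV (\<lambda>y. real_of_ereal (f y)) x :> ext_gradient f x"
proof -
  obtain L where L: "((\<lambda>y. real_of_ereal (f y)) has_derivative L) (at x)"
    using assms unfolding ext_differentiable_at_def differentiable_def by blast
  then interpret bounded_linear L by (rule has_derivative_bounded_linear)
  have "L h = h \<bullet> adjoint L 1" for h
    using adjoint_works [OF linear_axioms, of h 1] by simp
  then have "L = (\<lambda>h. h \<bullet> adjoint L 1)" by (rule ext)
  then have "GDERIV (\<lambda>y. real_of_ereal (f y)) x :> adjoint L 1"
    unfolding gderiv_def by (rule subst) (rule L)
  then show ?thesis by (simp only: ext_gradient_eq)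
qed

text \<open>
  The infimum is taken in \<^typ>\<open>ereal\<close>; if \<^term>\<open>f\<close> is finite but unbounded below, the
  right-hand side below is \<open>\<infinity>\<close> and the inequality fails.
\<close>

definition PL :: "real \<Rightarrow> ('a::real_inner \<Rightarrow> ereal) \<Rightarrow> bool" where
  "PL \<alpha> f \<longleftrightarrow>
     (\<forall>x. ereal ((norm (ext_gradient f x))\<^sup>2) \<ge> ereal (2 * \<alpha>) * (f x - (INF y. f y)))"

definition prox :: "real \<Rightarrow> ('a::real_normed_vector \<Rightarrow> ereal) \<Rightarrow> 'a \<Rightarrow> 'a set" where
  "prox \<eta> f y =
     {x. is_arg_min (\<lambda>x. f x + ereal (1 / (2 * \<eta>) * (norm (x - y))\<^sup>2)) (\<lambda>_. True) x}"

end

theory Submission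
  imports Defs
begin

text \<open>
  Write \<open>m = inf f\<close> and let \<open>u t = min\<^sub>y f y + (norm (y - x))\<^sup>2 / (2 * t)\<close> be the Moreau envelope
  of \<open>f\<close> at the fixed point \<open>x\<close>, attained at \<open>p t\<close>.  The first-order condition
  \<open>\<nabla>f (p t) = (x - p t) / t\<close> turns the penalty into \<open>(t / 2) * (norm (\<nabla>f (p t)))\<^sup>2\<close>, which the
  PL inequality compares with \<open>f (p t) - m\<close>.  This comparison is used twice, and each use yields
  one factor \<open>1 + \<alpha> * \<eta>\<close>.

  \<^item> At \<open>t = \<eta>\<close> it bounds the penalty from below, so \<open>(1 + \<alpha> * \<eta>) * (f x' - m) \<le> u \<eta> - m\<close>
    (\<open>PL_minimizer_bounds\<close>).

  \<^item> It also bounds the whole envelope: \<open>\<alpha> * (u t - m) \<le> (1 + \<alpha> * t) * (norm (\<nabla>f (p t)))\<^sup>2 / 2\<close>.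
    By the Hamilton-Jacobi equation \<open>u' t = - (norm (\<nabla>f (p t)))\<^sup>2 / 2\<close> this says that
    \<open>(1 + \<alpha> * t) * (u t - m)\<close> has nonpositive derivative.  As \<open>u t \<le> f x\<close>, letting the initial
    time tend to \<open>0\<close> gives \<open>(1 + \<alpha> * \<eta>) * (u \<eta> - m) \<le> f x - m\<close> (\<open>PL_envelope_decay\<close>).

  Differentiability of \<open>u\<close> is avoided: testing the minimum at time \<open>t'\<close> with the point \<open>p t\<close>
  bounds \<open>u t' - u t\<close> by the expected derivative up to a quadratic error
  (\<open>PL_envelope_step\<close>), and quadratic errors disappear under subdivision
  (\<open>le_if_quadratic_increments\<close>).
\<close>

section \<open>Monotonicity from quadratic increments\<close>

text \<open>
  Subdividing into \<open>n\<close> equal steps replaces the error \<open>K * (b - a)\<^sup>2\<close> by \<open>K * (b - a)\<^sup>2 / n\<close>.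
\<close>

lemma le_if_quadratic_increments:
  fixes \<phi> :: "real \<Rightarrow> real"
  assumes "a \<le> b"
    and inc: "\<And>s t. a \<le> s \<Longrightarrow> s \<le> t \<Longrightarrow> t \<le> b \<Longrightarrow> \<phi> t \<le> \<phi> s + K * (t - s)\<^sup>2"
  shows "\<phi> b \<le> \<phi> a"
proof -
  have bound: "\<phi> b \<le> \<phi> a + K * (b - a)\<^sup>2 * inverse (real (Suc n))" for n
  proof -
    define h where "h = (b - a) / real (Suc n)"
    have h: "0 \<le> h" "real (Suc n) * h = b - a"
      using \<open>a \<le> b\<close> by (simp_all add: h_def)
    have "k \<le> Suc n \<Longrightarrow> \<phi> (a + real k * h) \<le> \<phi> a + real k * (K * h\<^sup>2)" for k
    proof (induction k)
      case (Suc k)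
      have "real (Suc k) * h \<le> real (Suc n) * h"
        using Suc.prems h(1) by (intro mult_right_mono) auto
      then have "\<phi> (a + real (Suc k) * h) \<le> \<phi> (a + real k * h) + K * h\<^sup>2"
        using inc [of "a + real k * h" "a + real (Suc k) * h"] h by (simp add: algebra_simps)
      then show ?case
        using Suc by (simp add: algebra_simps)
    qed simp
    from this [of "Suc n"] have "\<phi> b \<le> \<phi> a + real (Suc n) * (K * h\<^sup>2)"
      using h(2) by simp
    also have "real (Suc n) * (K * h\<^sup>2) = K * (real (Suc n) * h) * h"
      by (simp add: power2_eq_square)
    also have "\<dots> = K * (b - a)\<^sup>2 * inverse (real (Suc n))"
      unfolding h(2) by (simp add: h_def power2_eq_square divide_inverse)
    finally show ?thesis .
  qed
  have "(\<lambda>n. \<phi> a + K * (b - a)\<^sup>2 * inverse (real (Suc n))) \<longlonglongrightarrow> \<phi> a + K * (b - a)\<^sup>2 * 0"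
    by (intro tendsto_intros LIMSEQ_inverse_real_of_nat)
  then have "(\<lambda>n. \<phi> a + K * (b - a)\<^sup>2 * inverse (real (Suc n))) \<longlonglongrightarrow> \<phi> a"
    by simp
  then show ?thesis
    by (rule LIMSEQ_le_const) (use bound in blast)
qed

section \<open>Minimizers of the proximal objective\<close>

text \<open>
  Beyond the radius at which the penalty exceeds \<open>F x - m\<close> the objective is above its value
  \<open>F x\<close> at the centre, so a minimizer over a ball is a global one.
\<close>

lemma proximal_minimizer_exists:
  fixes F :: "'a::euclidean_space \<Rightarrow> real"
  assumes "continuous_on UNIV F" and low: "\<And>y. m \<le> F y" and "0 < t"
  obtains p where "\<And>y. F p + (norm (p - x))\<^sup>2 / (2 * t) \<le> F y + (norm (y - x))\<^sup>2 / (2 * t)"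
proof -
  let ?J = "\<lambda>y. F y + (norm (y - x))\<^sup>2 / (2 * t)"
  define r where "r = sqrt (2 * t * (F x - m))"
  have r: "0 \<le> r" "r\<^sup>2 = 2 * t * (F x - m)"
    using low [of x] \<open>0 < t\<close> by (simp_all add: r_def)
  have "continuous_on (cball x r) ?J"
    using \<open>0 < t\<close> by (intro continuous_intros continuous_on_subset [OF assms(1)]) auto
  then have "\<exists>p\<in>cball x r. \<forall>y\<in>cball x r. ?J p \<le> ?J y"
    using r(1) by (intro continuous_attains_inf) auto
  then obtain p where p: "\<And>y. y \<in> cball x r \<Longrightarrow> ?J p \<le> ?J y"
    by blast
  have "?J p \<le> ?J y" for y
  proof (cases "y \<in> cball x r")
    case False
    then have "r\<^sup>2 \<le> (norm (y - x))\<^sup>2"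
      using r(1) by (intro power_mono) (auto simp: dist_norm norm_minus_commute)
    then have "F x - m \<le> (norm (y - x))\<^sup>2 / (2 * t)"
      using r(2) \<open>0 < t\<close> by (simp add: field_simps)
    moreover have "?J p \<le> F x"
      using p [of x] r(1) by simp
    ultimately show ?thesis
      using low [of y] by linarith
  qed (rule p)
  then show thesis by (rule that)
qed

lemma proximal_gradient_eq:
  fixes F :: "'a::euclidean_space \<Rightarrow> real"
  assumes "GDERIV F p :> g" and "0 < t"
    and min: "\<And>y. F p + (norm (p - x))\<^sup>2 / (2 * t) \<le> F y + (norm (y - x))\<^sup>2 / (2 * t)"
  shows "g = (1 / t) *\<^sub>R (x - p)"
proof -
  let ?J = "\<lambda>y. F y + ((y - x) \<bullet> (y - x)) / (2 * t)"
  let ?D = "\<lambda>h. h \<bullet> g + ((p - x) \<bullet> h + h \<bullet> (p - x)) / (2 * t)"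
  have "(F has_derivative (\<lambda>h. h \<bullet> g)) (at p)"
    using assms(1) by (simp add: gderiv_def)
  then have "(?J has_derivative ?D) (at p)"
    using \<open>0 < t\<close> by (auto intro!: derivative_eq_intros simp: fun_eq_iff field_simps)
  then have "?D = (\<lambda>h. 0)"
    using min by (intro differential_zero_maxmin [where S = UNIV and f = ?J])
      (auto simp: power2_norm_eq_inner)
  then have crit: "h \<bullet> g + (p - x) \<bullet> h / t = 0" for h
    using fun_cong [of ?D "\<lambda>h. 0" h] by (simp add: inner_commute)
  have "h \<bullet> (g - (1 / t) *\<^sub>R (x - p)) = 0" for h
    using crit [of h]
    by (simp add: inner_diff_right inner_diff_left inner_commute [of h] diff_divide_distrib)
  then show ?thesis
    using inner_eq_zero_iff [of "g - (1 / t) *\<^sub>R (x - p)"] by simp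
qed

text \<open>
  The two consequences of the PL inequality at a minimizer: the first bounds the envelope by its
  own rate of decrease \<open>(norm (p - x))\<^sup>2 / (2 * t\<^sup>2)\<close>, the second bounds it from below by the
  objective gap at the minimizer.
\<close>

lemma PL_minimizer_bounds:
  fixes F :: "'a::euclidean_space \<Rightarrow> real"
  assumes g: "GDERIV F p :> g" and PL: "2 * \<alpha> * (F p - m) \<le> (norm g)\<^sup>2" and t: "0 < t"
    and min: "\<And>y. F p + (norm (p - x))\<^sup>2 / (2 * t) \<le> F y + (norm (y - x))\<^sup>2 / (2 * t)"
  defines "u \<equiv> F p + (norm (p - x))\<^sup>2 / (2 * t)"
  shows "\<alpha> * (u - m) \<le> (1 + \<alpha> * t) * ((norm (p - x))\<^sup>2 / (2 * t\<^sup>2))"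
    and "(1 + \<alpha> * t) * (F p - m) \<le> u - m"
proof -
  define e where "e = (norm (p - x))\<^sup>2 / (2 * t\<^sup>2)"
  have "(norm g)\<^sup>2 = 2 * e"
    using proximal_gradient_eq [OF g t min] t
    by (simp add: e_def power_mult_distrib power_divide norm_minus_commute)
  then have gap: "\<alpha> * (F p - m) \<le> e"
    using PL by simp
  have u: "u = F p + t * e"
    using t by (simp add: u_def e_def power2_eq_square)
  show "\<alpha> * (u - m) \<le> (1 + \<alpha> * t) * ((norm (p - x))\<^sup>2 / (2 * t\<^sup>2))"
    using gap unfolding u e_def [symmetric] by (simp add: algebra_simps)
  show "(1 + \<alpha> * t) * (F p - m) \<le> u - m"
    using mult_left_mono [OF gap, of t] t unfolding u by (simp add: algebra_simps)
qed

section \<open>Decay of the Moreau envelope\<close>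

text \<open>
  One explicit step of the differential inequality, where \<open>w\<close> and \<open>v\<close> stand for the envelope gap
  at the times \<open>t\<close> and \<open>s\<close>, and \<open>e\<close> for the rate of decrease at \<open>t\<close>.  With
  \<open>q = \<alpha> * (s - t) / (1 + \<alpha> * t)\<close> the weight grows by the factor \<open>1 + q\<close>, while the gap shrinks
  at least by the factor \<open>1 - q * t / s\<close>; the first-order terms of the product cancel up to
  \<open>q * (s - t) / s\<close>, which is quadratic in the step.
\<close>

lemma PL_envelope_step:
  fixes w v e :: real
  assumes pos: "0 < \<alpha>" "0 < t" "t \<le> s" and "0 \<le> w"
    and rate: "\<alpha> * w \<le> (1 + \<alpha> * t) * e"
    and dec: "v \<le> w - e * t * (s - t) / s"
  shows "(1 + \<alpha> * s) * v \<le> (1 + \<alpha> * t) * w + \<alpha> * w * (s - t)\<^sup>2 / s"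
proof -
  define c where "c = 1 + \<alpha> * t"
  define d where "d = s - t"
  have c: "1 \<le> c" and d: "0 \<le> d" and s: "0 < s"
    using pos by (simp_all add: c_def d_def)
  have cd: "1 + \<alpha> * s = c + \<alpha> * d"
    by (simp add: c_def d_def algebra_simps)
  have e: "0 \<le> e"
    using rate pos \<open>0 \<le> w\<close> c by (smt (verit) c_def mult_nonneg_nonneg mult_pos_neg)
  define k where "k = t * d / s"
  have k: "0 \<le> k"
    using pos d s by (simp add: k_def)
  have "(1 + \<alpha> * s) * v \<le> (c + \<alpha> * d) * (w - e * k)"
    unfolding cd using dec pos c d by (intro mult_left_mono) (auto simp: d_def k_def)
  also have "\<dots> = c * w + \<alpha> * w * d - (c * e) * k - \<alpha> * d * (e * k)"
    by (simp add: algebra_simps)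
  also have "\<dots> \<le> c * w + \<alpha> * w * d - (\<alpha> * w) * k"
  proof -
    have "(\<alpha> * w) * k \<le> (c * e) * k"
      using rate k by (intro mult_right_mono) (auto simp: c_def)
    moreover have "0 \<le> \<alpha> * d * (e * k)"
      using pos d e k by simp
    ultimately show ?thesis by linarith
  qed
  also have "\<dots> = c * w + \<alpha> * w * d\<^sup>2 / s"
    using s by (simp add: k_def d_def power2_eq_square field_simps)
  finally show ?thesis by (simp add: c_def d_def)
qed

text \<open>
  The weighted envelope gap \<open>(1 + \<alpha> * t) * (u t - m)\<close> is nonincreasing on \<open>(0, \<eta>]\<close>.  The quadratic
  error of a step carries a factor \<open>1 / a\<close> when the steps start at time \<open>a\<close>, so the comparison is
  made on \<open>[a, \<eta>]\<close> for each \<open>a > 0\<close>, and \<open>a\<close> tends to \<open>0\<close> only afterwards.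
\<close>

lemma PL_envelope_decay:
  fixes F :: "'a::euclidean_space \<Rightarrow> real"
  assumes G: "\<And>y. GDERIV F y :> G y" and low: "\<And>y. m \<le> F y"
    and PL: "\<And>y. 2 * \<alpha> * (F y - m) \<le> (norm (G y))\<^sup>2"
    and "0 < \<alpha>" "0 < \<eta>"
    and min: "\<And>y. F x' + (norm (x' - x))\<^sup>2 / (2 * \<eta>) \<le> F y + (norm (y - x))\<^sup>2 / (2 * \<eta>)"
  shows "(1 + \<alpha> * \<eta>) * (F x' + (norm (x' - x))\<^sup>2 / (2 * \<eta>) - m) \<le> F x - m"
proof -
  have cont: "continuous_on UNIV F"
    using G by (auto simp: continuous_on_eq_continuous_at gderiv_def intro: has_derivative_continuous)
  have "\<exists>p. \<forall>y. F p + (norm (p - x))\<^sup>2 / (2 * t) \<le> F y + (norm (y - x))\<^sup>2 / (2 * t)"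
    if "0 < t" for t
    using proximal_minimizer_exists [OF cont low that] by metis
  then obtain p where
    p: "\<And>t y. 0 < t \<Longrightarrow> F (p t) + (norm (p t - x))\<^sup>2 / (2 * t) \<le> F y + (norm (y - x))\<^sup>2 / (2 * t)"
    by metis
  define w where "w t = F (p t) + (norm (p t - x))\<^sup>2 / (2 * t) - m" for t
  define \<phi> where "\<phi> t = (1 + \<alpha> * t) * w t" for t
  have w0: "0 \<le> w t" and wx: "w t \<le> F x - m" if "0 < t" for t
  proof -
    have "0 \<le> (norm (p t - x))\<^sup>2 / (2 * t)"
      using that by simp
    then show "0 \<le> w t"
      using low [of "p t"] unfolding w_def by linarith
    show "w t \<le> F x - m"
      using p [OF that, of x] by (simp add: w_def)
  qed
  have decay: "\<phi> \<eta> \<le> (1 + \<alpha> * a) * (F x - m)" if a: "0 < a" "a \<le> \<eta>" for a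
  proof -
    have "\<phi> \<eta> \<le> \<phi> a"
    proof (rule le_if_quadratic_increments [where \<phi> = \<phi> and K = "\<alpha> * (F x - m) / a"])
      show "a \<le> \<eta>" by (rule a)
      fix t s assume ts: "a \<le> t" "t \<le> s" "s \<le> \<eta>"
      then have t: "0 < t" and s: "0 < s"
        using a by auto
      define e where "e = (norm (p t - x))\<^sup>2 / (2 * t\<^sup>2)"
      \<comment> \<open>The point \<open>p t\<close> competes in the minimization at the later time \<open>s\<close>.\<close>
      have "w s \<le> F (p t) + (norm (p t - x))\<^sup>2 / (2 * s) - m"
        using p [OF s, of "p t"] by (simp add: w_def)
      also have "\<dots> = w t - e * t * (s - t) / s"
        using t s by (simp add: w_def e_def power2_eq_square field_simps)
      finally have "w s \<le> w t - e * t * (s - t) / s" .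
      moreover have "\<alpha> * w t \<le> (1 + \<alpha> * t) * e"
        unfolding w_def e_def by (rule PL_minimizer_bounds(1) [OF G PL t p [OF t]])
      ultimately have "\<phi> s \<le> \<phi> t + \<alpha> * w t * (s - t)\<^sup>2 / s"
        unfolding \<phi>_def using PL_envelope_step [OF \<open>0 < \<alpha>\<close> t \<open>t \<le> s\<close> w0 [OF t]] by blast
      also have "\<alpha> * w t * (s - t)\<^sup>2 / s \<le> \<alpha> * (F x - m) * (s - t)\<^sup>2 / a"
        using w0 [OF t] wx [OF t] \<open>0 < \<alpha>\<close> a ts
        by (intro frac_le mult_right_mono mult_left_mono mult_nonneg_nonneg) auto
      finally show "\<phi> s \<le> \<phi> t + \<alpha> * (F x - m) / a * (s - t)\<^sup>2"
        by simp
    qed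
    also have "\<dots> \<le> (1 + \<alpha> * a) * (F x - m)"
      unfolding \<phi>_def using wx [of a] a \<open>0 < \<alpha>\<close> by (intro mult_left_mono) auto
    finally show ?thesis .
  qed
  have "((\<lambda>a. (1 + \<alpha> * a) * (F x - m)) \<longlongrightarrow> (1 + \<alpha> * 0) * (F x - m)) (at_right 0)"
    by (intro tendsto_intros)
  moreover have "\<forall>\<^sub>F a in at_right 0. \<phi> \<eta> \<le> (1 + \<alpha> * a) * (F x - m)"
    using decay \<open>0 < \<eta>\<close> by (auto simp: eventually_at_right_field intro!: exI [of _ \<eta>])
  ultimately have "\<phi> \<eta> \<le> F x - m"
    using tendsto_lowerbound by fastforce
  moreover have "w \<eta> = F x' + (norm (x' - x))\<^sup>2 / (2 * \<eta>) - m"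
    using min [of "p \<eta>"] p [OF \<open>0 < \<eta>\<close>, of x'] by (simp add: w_def)
  ultimately show ?thesis
    by (simp add: \<phi>_def)
qed

section \<open>Contraction of the proximal step\<close>

theorem theorem9:
  fixes f :: "real ^ 'n \<Rightarrow> ereal" and \<alpha> \<eta> :: real and x x' :: "real ^ 'n"
  assumes "\<And>y. f y \<noteq> -\<infinity>"
    and "ext_differentiable f"
    and "\<alpha> > 0"
    and "PL \<alpha> f"
    and "\<eta> > 0"
    and "x' \<in> prox \<eta> f x"
  shows "f x' - (INF y. f y) \<le> ereal (1 / (1 + \<alpha> * \<eta>)\<^sup>2) * (f x - (INF y. f y))"
proof -
  define F where "F y = real_of_ereal (f y)" for y
  have "\<bar>f y\<bar> \<noteq> \<infinity>" for y
  proof -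
    have "\<forall>\<^sub>F z in nhds y. \<bar>f z\<bar> \<noteq> \<infinity>"
      using assms(2) by (simp add: ext_differentiable_def ext_differentiable_at_def)
    then show ?thesis by (rule eventually_nhds_x_imp_x)
  qed
  then have f: "f y = ereal (F y)" for y
    by (simp add: F_def ereal_real)
  have G: "GDERIV F y :> ext_gradient f y" for y
    using GDERIV_ext_gradient [of f y] assms(2)
    by (simp add: ext_differentiable_def F_def [abs_def])
  have PLf: "ereal (2 * \<alpha>) * (ereal (F y) - (INF y. f y)) \<le> ereal ((norm (ext_gradient f y))\<^sup>2)" for y
    using assms(4) by (simp add: PL_def f)
  \<comment> \<open>A function unbounded below would have infinite gap, against the finite squared gradient.\<close>
  have "(INF y. f y) \<noteq> -\<infinity>"
    using PLf [of x] \<open>\<alpha> > 0\<close> by auto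
  moreover have "(INF y. f y) \<noteq> \<infinity>"
    using INF_lower [of x UNIV f] f [of x] by auto
  ultimately obtain m where m: "(INF y. f y) = ereal m"
    by (cases "INF y. f y") auto
  have low: "m \<le> F y" for y
    using INF_lower [of y UNIV f] by (simp add: f m[unfolded f])
  have PL: "2 * \<alpha> * (F y - m) \<le> (norm (ext_gradient f y))\<^sup>2" for y
    using PLf [of y] by (simp add: m)
  have min: "F x' + (norm (x' - x))\<^sup>2 / (2 * \<eta>) \<le> F y + (norm (y - x))\<^sup>2 / (2 * \<eta>)" for y
    using assms(6) by (auto simp: prox_def is_arg_min_linorder f)
  let ?c = "1 + \<alpha> * \<eta>"
  have c: "0 < ?c"
    using \<open>\<alpha> > 0\<close> \<open>\<eta> > 0\<close> by (simp add: add_pos_pos)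
  have "?c * (?c * (F x' - m)) \<le> ?c * (F x' + (norm (x' - x))\<^sup>2 / (2 * \<eta>) - m)"
    using PL_minimizer_bounds(2) [OF G PL \<open>\<eta> > 0\<close> min] c by (intro mult_left_mono) auto
  also have "\<dots> \<le> F x - m"
    by (rule PL_envelope_decay [OF G low PL \<open>\<alpha> > 0\<close> \<open>\<eta> > 0\<close> min])
  finally have "F x' - m \<le> 1 / ?c\<^sup>2 * (F x - m)"
    using c by (simp add: pos_le_divide_eq power2_eq_square mult_ac)
  then show ?thesis
    unfolding m by (simp add: f)
qed

end
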